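(* Let $\mathfrak g=\mathfrak{sl}(4|1)$ over $\mathbb{C}$. There exists a unique sub-superalgebra $\mathfrak p$ of $\mathfrak g$ satisfying the following three conditions: 1. $\mathfrak p$ is a parabolic superalgebra, i.e. it contains a Borel sub-superalgebra of $\mathfrak g$ (normalized so that its intersection with $\mathfrak g_0$ is the standard Borel of $\mathfrak g_0$). 2. $\mathfrak p\cap\mathfrak g_0$ is the parabolic subalgebra of $\mathfrak g_0$ consisting of the matrices in $\mathfrak g_0$ of the form $$\begin{pmatrix} L & 0 & 0 \\ M & R & 0 \\ 0 & 0 & c \end{pmatrix},$$ with $L,M,R$ complex $2\times2$ matrices and $c$ a scalar. 3. There is a sub-superalgebra $\mathfrak n\subset\mathfrak g$ such that $\mathfrak g=\mathfrak p\oplus\mathfrak n$ (as vector spaces) and $\mathfrak n$ is a (complex) translation superalgebra with respect to the adjoint action of the Lorentz algebra $\mathfrak l_0$. Namely, $\mathfrak g=\mathfrak p\oplus\mathfrak n$ where $$\mathfrak p=\left\{\begin{pmatrix} L & 0 & 0 \\ M & R & \alpha \\ \beta & 0 & c \end{pmatrix}\right\},\qquad \mathfrak n=\left\{\begin{pmatrix} 0 & A & \gamma \\ 0 & 0 & 0 \\ 0 & \delta & 0 \end{pmatrix}\right\},$$ with $L,M,R,A$ complex $2\times2$ matrices, $\alpha,\gamma$ of size $2\times1$, $\beta,\delta$ of size $1\times2$, $c$ a scalar, and $c=\mathrm{tr}(L)+\mathrm{tr}(R)$.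
   Context: $\mathfrak{sl}(4|1)$ is the complex Lie superalgebra of $5\times5$ matrices $\begin{pmatrix} X & \mu \\ \nu & x \end{pmatrix}$ ($X$ of size $4\times4$, $\mu$ of size $4\times1$, $\nu$ of size $1\times4$, $x$ a scalar) with supertrace $\mathrm{tr}(X)-x=0$, with the usual super-commutator; the even part $\mathfrak g_0$ is given by $\mu=0,\nu=0$, and the odd part $\mathfrak g_1$ by $X=0,x=0$. Matrices in the claim are written in blocks of sizes $2,2,1$. The Cartan subalgebra consists of the diagonal matrices in $\mathfrak g$. A Borel sub-superalgebra is the sum of the Cartan subalgebra and the root spaces of a system of positive roots associated with a total ordering of the five coordinate indices (i.e. matrices triangular with respect to some ordering of the standard basis); the standard Borel of $\mathfrak g_0$ is here the one consisting of lower triangular matrices (the one contained in the parabolic subalgebra of condition 2). The Lorentz algebra is $\mathfrak l_0=\{\mathrm{diag}(L,R,0)\mid L,R\in\mathfrak{sl}_2(\mathbb{C})\}\cong\mathfrak{sl}_2\oplus\mathfrak{sl}_2$. $D(1/2,0)$ and $D(0,1/2)$ denote the two-dimensional irreducible $\mathfrak l_0$-modules on which only the first, respectively only the second, $\mathfrak{sl}_2$ factor acts nontrivially. A (complex) translation superalgebra is a Lie superalgebra $\mathfrak n=\mathfrak n_0+\mathfrak n_1$ carrying an action of $\mathfrak l_0$ such that $\mathfrak n_0$ is an abelian Lie algebra of dimension 4 acting trivially on $\mathfrak n_1$, $\mathfrak n_1$ has dimension 4 with $\mathfrak n_1\simeq D(1/2,0)\oplus D(0,1/2)$ as an $\mathfrak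 l_0$-module, and the odd commutator is a nonzero symmetric $\mathfrak l_0$-equivariant map $\mathfrak n_1\times\mathfrak n_1\to\mathfrak n_0$. *)

theory Defs
  imports "HOL-Analysis.Analysis" "HOL-Library.Z2"
begin

text \<open>The first four coordinates (the two summands of type \<open>2\<close>) are even and the last one is
  odd. The type \<open>2\<close> is used through its elements \<open>1\<close> and \<open>2\<close> in this order; since
  \<open>2 = 0 < 1\<close> in its library order, the ordering of the coordinates is fixed by \<open>position\<close>.\<close>

type_synonym idx = "(2 + 2) + 1"
type_synonym mat5 = "complex^idx^idx"

fun position :: "idx \<Rightarrow> nat" where
  "position (Inl (Inl k)) = (if k = 1 then 1 else 2)"
| "position (Inl (Inr k)) = (if k = 1 then 3 else 4)"
| "position (Inr _) = 5"

fun parity :: "idx \<Rightarrow> bit" where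
  "parity (Inl _) = 0"
| "parity (Inr _) = 1"

text \<open>\<open>blocks L A \<gamma> M R \<alpha> \<beta> \<delta> c\<close> is the matrix with block rows \<open>(L A \<gamma>)\<close>, \<open>(M R \<alpha>)\<close>,
  \<open>(\<beta> \<delta> c)\<close>.\<close>

fun block_entry ::
  "complex^2^2 \<Rightarrow> complex^2^2 \<Rightarrow> complex^2 \<Rightarrow>
   complex^2^2 \<Rightarrow> complex^2^2 \<Rightarrow> complex^2 \<Rightarrow>
   complex^2 \<Rightarrow> complex^2 \<Rightarrow> complex \<Rightarrow> idx \<Rightarrow> idx \<Rightarrow> complex" where
  "block_entry L A \<gamma> M R \<alpha> \<beta> \<delta> c (Inl (Inl i)) (Inl (Inl j)) = L $ i $ j"
| "block_entry L A \<gamma> M R \<alpha> \<beta> \<delta> c (Inl (Inl i)) (Inl (Inr j)) = A $ i $ j"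
| "block_entry L A \<gamma> M R \<alpha> \<beta> \<delta> c (Inl (Inl i)) (Inr _) = \<gamma> $ i"
| "block_entry L A \<gamma> M R \<alpha> \<beta> \<delta> c (Inl (Inr i)) (Inl (Inl j)) = M $ i $ j"
| "block_entry L A \<gamma> M R \<alpha> \<beta> \<delta> c (Inl (Inr i)) (Inl (Inr j)) = R $ i $ j"
| "block_entry L A \<gamma> M R \<alpha> \<beta> \<delta> c (Inl (Inr i)) (Inr _) = \<alpha> $ i"
| "block_entry L A \<gamma> M R \<alpha> \<beta> \<delta> c (Inr _) (Inl (Inl j)) = \<beta> $ j"
| "block_entry L A \<gamma> M R \<alpha> \<beta> \<delta> c (Inr _) (Inl (Inr j)) = \<delta> $ j"
| "block_entry L A \<gamma> M R \<alpha> \<beta> \<delta> c (Inr _) (Inr _) = c"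

definition blocks ::
  "complex^2^2 \<Rightarrow> complex^2^2 \<Rightarrow> complex^2 \<Rightarrow>
   complex^2^2 \<Rightarrow> complex^2^2 \<Rightarrow> complex^2 \<Rightarrow>
   complex^2 \<Rightarrow> complex^2 \<Rightarrow> complex \<Rightarrow> mat5" where
  "blocks L A \<gamma> M R \<alpha> \<beta> \<delta> c = (\<chi> i j. block_entry L A \<gamma> M R \<alpha> \<beta> \<delta> c i j)"

text \<open>Type \<open>mat5\<close> only comes with a real scalar multiplication in the library.\<close>

definition mscale :: "complex \<Rightarrow> mat5 \<Rightarrow> mat5" where
  "mscale c A = (\<chi> i j. c * A $ i $ j)"

global_interpretation cmat: vector_space mscale
  by unfold_locales (simp_all add: mscale_def vec_eq_iff algebra_simps)

definition hpart :: "bit \<Rightarrow> mat5 \<Rightarrow> mat5" where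
  "hpart p A = (\<chi> i j. if parity i + parity j = p then A $ i $ j else 0)"

definition supertrace :: "mat5 \<Rightarrow> complex" where
  "supertrace A = (\<Sum>i\<in>UNIV. A $ Inl i $ Inl i) - (\<Sum>i\<in>UNIV. A $ Inr i $ Inr i)"

text \<open>Bilinear extension of \<open>AB - (-1)\<^bsup>pq\<^esup> BA\<close> for \<open>A\<close>, \<open>B\<close> of parities \<open>p\<close>, \<open>q\<close>.\<close>

definition sbracket :: "mat5 \<Rightarrow> mat5 \<Rightarrow> mat5" where
  "sbracket A B =
     (hpart 0 A ** hpart 0 B - hpart 0 B ** hpart 0 A)
   + (hpart 0 A ** hpart 1 B - hpart 1 B ** hpart 0 A)
   + (hpart 1 A ** hpart 0 B - hpart 0 B ** hpart 1 A)
   + (hpart 1 A ** hpart 1 B + hpart 1 B ** hpart 1 A)"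

definition sl41 :: "mat5 set" where
  "sl41 = {A. supertrace A = 0}"

definition sl41_part :: "bit \<Rightarrow> mat5 set" where
  "sl41_part p = {A \<in> sl41. hpart p A = A}"

definition sub_superalgebra :: "mat5 set \<Rightarrow> bool" where
  "sub_superalgebra S \<longleftrightarrow>
     S \<subseteq> sl41 \<and> cmat.subspace S \<and>
     S = {x + y | x y. x \<in> S \<inter> sl41_part 0 \<and> y \<in> S \<inter> sl41_part 1} \<and>
     (\<forall>x\<in>S. \<forall>y\<in>S. sbracket x y \<in> S)"

text \<open>\<open>(j, i) \<in> r\<close> means that \<open>j\<close> precedes \<open>i\<close> or \<open>j = i\<close>, so these are the matrices that are
  lower triangular after reordering the coordinates according to \<open>r\<close>.\<close>

definition borel_of :: "idx rel \<Rightarrow> mat5 set" where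
  "borel_of r = {A \<in> sl41. \<forall>i j. A $ i $ j \<noteq> 0 \<longrightarrow> (j, i) \<in> r}"

definition borel_subalgebra :: "mat5 set \<Rightarrow> bool" where
  "borel_subalgebra b \<longleftrightarrow> (\<exists>r. linear_order r \<and> b = borel_of r)"

definition standard_borel_even :: "mat5 set" where
  "standard_borel_even = {A \<in> sl41_part 0. \<forall>i j. A $ i $ j \<noteq> 0 \<longrightarrow> position j \<le> position i}"

definition parabolic_superalgebra :: "mat5 set \<Rightarrow> bool" where
  "parabolic_superalgebra p \<longleftrightarrow>
     sub_superalgebra p \<and>
     (\<exists>b. borel_subalgebra b \<and> b \<inter> sl41_part 0 = standard_borel_even \<and> b \<subseteq> p)"

definition parabolic_even :: "mat5 set" where
  "parabolic_even = {blocks L 0 0 M R 0 0 0 c | L M R c. True} \<inter> sl41_part 0"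

definition lorentz :: "mat5 set" where
  "lorentz = {blocks L 0 0 0 R 0 0 0 0 | L R. trace L = 0 \<and> trace R = 0}"

locale lorentz_module = vector_space scale
  for scale :: "complex \<Rightarrow> 'v::ab_group_add \<Rightarrow> 'v" +
  fixes W :: "'v set" and act :: "mat5 \<Rightarrow> 'v \<Rightarrow> 'v"
  assumes carrier_subspace: "subspace W"
    and act_closed: "X \<in> lorentz \<Longrightarrow> v \<in> W \<Longrightarrow> act X v \<in> W"
    and act_add: "X \<in> lorentz \<Longrightarrow> v \<in> W \<Longrightarrow> w \<in> W \<Longrightarrow> act X (v + w) = act X v + act X w"
    and act_scale: "X \<in> lorentz \<Longrightarrow> v \<in> W \<Longrightarrow> act X (scale a v) = scale a (act X v)"
    and add_act: "X \<in> lorentz \<Longrightarrow> Y \<in> lorentz \<Longrightarrow> v \<in> W \<Longrightarrow> act (X + Y) v = act X v + act Y v"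
    and scale_act: "X \<in> lorentz \<Longrightarrow> v \<in> W \<Longrightarrow> act (mscale a X) v = scale a (act X v)"
    and act_bracket: "X \<in> lorentz \<Longrightarrow> Y \<in> lorentz \<Longrightarrow> v \<in> W \<Longrightarrow>
      act (X ** Y - Y ** X) v = act X (act Y v) - act Y (act X v)"

definition lorentz_isomorphic ::
  "(complex \<Rightarrow> 'v::ab_group_add \<Rightarrow> 'v) \<Rightarrow> 'v set \<Rightarrow> (mat5 \<Rightarrow> 'v \<Rightarrow> 'v) \<Rightarrow>
   (complex \<Rightarrow> 'w::ab_group_add \<Rightarrow> 'w) \<Rightarrow> 'w set \<Rightarrow> (mat5 \<Rightarrow> 'w \<Rightarrow> 'w) \<Rightarrow> bool" where
  "lorentz_isomorphic s W act s' W' act' \<longleftrightarrow>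
     (\<exists>f. bij_betw f W W' \<and>
       (\<forall>v\<in>W. \<forall>w\<in>W. f (v + w) = f v + f w) \<and>
       (\<forall>v\<in>W. \<forall>a. f (s a v) = s' a (f v)) \<and>
       (\<forall>X\<in>lorentz. \<forall>v\<in>W. f (act X v) = act' X (f v)))"

text \<open>The modules \<open>D(1/2,0)\<close> and \<open>D(0,1/2)\<close>, realized on \<open>complex^2\<close> by letting
  \<open>diag(L, R, 0)\<close> act as \<open>L\<close>, respectively as \<open>R\<close>. These are the
  two-dimensional irreducible modules on which only one factor acts: see
  \<open>D_half_0_irreducible\<close> and \<open>D_0_half_irreducible\<close>.\<close>

definition D_half_0 :: "mat5 \<Rightarrow> complex^2 \<Rightarrow> complex^2" where
  "D_half_0 X v = (\<chi> i j. X $ Inl (Inl i) $ Inl (Inl j)) *v v"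

definition D_0_half :: "mat5 \<Rightarrow> complex^2 \<Rightarrow> complex^2" where
  "D_0_half X v = (\<chi> i j. X $ Inl (Inr i) $ Inl (Inr j)) *v v"

lemma D_half_0_blocks: "D_half_0 (blocks L A \<gamma> M R \<alpha> \<beta> \<delta> c) v = L *v v"
  and D_0_half_blocks: "D_0_half (blocks L A \<gamma> M R \<alpha> \<beta> \<delta> c) v = R *v v"
  by (simp_all add: D_half_0_def D_0_half_def blocks_def matrix_vector_mult_def)

lemma sum_sum_type:
  "(\<Sum>k\<in>UNIV. f k) = (\<Sum>i\<in>UNIV. f (Inl i)) + (\<Sum>j\<in>UNIV. f (Inr j))"
  for f :: "'i::finite + 'j::finite \<Rightarrow> 'a::comm_monoid_add"
  by (simp add: sum.Plus[of UNIV UNIV f, simplified UNIV_Plus_UNIV] comp_def)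

lemma lorentz_module_D_half_0: "lorentz_module (*s) UNIV D_half_0"
  by unfold_locales
     (auto simp: D_half_0_def lorentz_def blocks_def mscale_def vec_eq_iff sum_2 sum_sum_type
        matrix_matrix_mult_def matrix_vector_mult_def algebra_simps)

lemma lorentz_module_D_0_half: "lorentz_module (*s) UNIV D_0_half"
  by unfold_locales
     (auto simp: D_0_half_def lorentz_def blocks_def mscale_def vec_eq_iff sum_2 sum_sum_type
        matrix_matrix_mult_def matrix_vector_mult_def algebra_simps)

lemma sl2_irreducible:
  fixes W :: "(complex^2) set"
  assumes W: "vec.subspace W"
    and stable: "\<And>L v. trace L = 0 \<Longrightarrow> v \<in> W \<Longrightarrow> (L :: complex^2^2) *v v \<in> W"
  shows "W = {0} \<or> W = UNIV"
proof (rule disjCI)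
  assume "W \<noteq> UNIV"
  show "W = {0}"
  proof (rule ccontr)
    assume "W \<noteq> {0}"
    with vec.subspace_0[OF W] obtain w where w: "w \<in> W" "w \<noteq> 0" by blast
    define E :: "complex^2^2" where "E = (\<chi> i j. if i = 1 \<and> j = 2 then 1 else 0)"
    define F :: "complex^2^2" where "F = (\<chi> i j. if i = 2 \<and> j = 1 then 1 else 0)"
    have tr: "trace E = 0" "trace F = 0" by (simp_all add: E_def F_def trace_def sum_2)
    have Ev: "E *v v = vector [v $ 2, 0]" and Fv: "F *v v = vector [0, v $ 1]" for v
      by (simp_all add: E_def F_def matrix_vector_mult_def vec_eq_iff forall_2 sum_2)
    have E_W: "vector [v $ 2, 0] \<in> W" and F_W: "vector [0, v $ 1] \<in> W" if "v \<in> W" for v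
      using stable[OF tr(1) that] stable[OF tr(2) that] by (simp_all add: Ev Fv)
    obtain a where a: "a \<noteq> 0" "vector [a, 0] \<in> W"
    proof (cases "w $ 2 = 0")
      case False then show ?thesis using E_W[OF w(1)] that by blast
    next
      case True
      then have "w $ 1 \<noteq> 0" using w(2) by (simp add: vec_eq_iff forall_2)
      then show ?thesis using E_W[OF F_W[OF w(1)]] that by simp
    qed
    then have a': "vector [0, a] \<in> W" using F_W by fastforce
    have "v \<in> W" for v :: "complex^2"
    proof -
      have "v = (v $ 1 / a) *s vector [a, 0] + (v $ 2 / a) *s vector [0, a]"
        using a(1) by (simp add: vec_eq_iff forall_2)
      then show ?thesis
        using a(2) a' by (metis W vec.subspace_add vec.subspace_scale)
    qed
    with \<open>W \<noteq> UNIV\<close> show False by blast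
  qed
qed

lemma D_half_0_irreducible:
  assumes "vec.subspace W" "\<And>X v. X \<in> lorentz \<Longrightarrow> v \<in> W \<Longrightarrow> D_half_0 X v \<in> W"
  shows "W = {0} \<or> W = UNIV"
proof (rule sl2_irreducible[OF assms(1)])
  fix L :: "complex^2^2" and v assume "trace L = 0" "v \<in> W"
  moreover have "blocks L 0 0 0 0 0 0 0 0 \<in> lorentz"
    unfolding lorentz_def using \<open>trace L = 0\<close> by (fastforce simp: trace_def)
  ultimately show "L *v v \<in> W" using assms(2) D_half_0_blocks by metis
qed

lemma D_0_half_irreducible:
  assumes "vec.subspace W" "\<And>X v. X \<in> lorentz \<Longrightarrow> v \<in> W \<Longrightarrow> D_0_half X v \<in> W"
  shows "W = {0} \<or> W = UNIV"
proof (rule sl2_irreducible[OF assms(1)])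
  fix R :: "complex^2^2" and v assume "trace R = 0" "v \<in> W"
  moreover have "blocks 0 0 0 0 R 0 0 0 0 \<in> lorentz"
    unfolding lorentz_def using \<open>trace R = 0\<close> by (fastforce simp: trace_def)
  ultimately show "R *v v \<in> W" using assms(2) D_0_half_blocks by metis
qed

definition D_sum_scale :: "complex \<Rightarrow> (complex^2) \<times> (complex^2) \<Rightarrow> (complex^2) \<times> (complex^2)" where
  "D_sum_scale a = map_prod ((*s) a) ((*s) a)"

definition D_sum :: "mat5 \<Rightarrow> (complex^2) \<times> (complex^2) \<Rightarrow> (complex^2) \<times> (complex^2)" where
  "D_sum X = map_prod (D_half_0 X) (D_0_half X)"

locale lie_superalgebra = vector_space scale
  for scale :: "complex \<Rightarrow> 'v::ab_group_add \<Rightarrow> 'v" +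
  fixes V :: "bit \<Rightarrow> 'v set" and br :: "'v \<Rightarrow> 'v \<Rightarrow> 'v"
  assumes part_subspace: "subspace (V p)"
    and parts_independent: "V 0 \<inter> V 1 = {0}"
    and br_closed: "x \<in> V p \<Longrightarrow> y \<in> V q \<Longrightarrow> br x y \<in> V (p + q)"
    and br_add_left: "\<lbrakk>x \<in> span (V 0 \<union> V 1); x' \<in> span (V 0 \<union> V 1); y \<in> span (V 0 \<union> V 1)\<rbrakk>
      \<Longrightarrow> br (x + x') y = br x y + br x' y"
    and br_add_right: "\<lbrakk>x \<in> span (V 0 \<union> V 1); y \<in> span (V 0 \<union> V 1); y' \<in> span (V 0 \<union> V 1)\<rbrakk>
      \<Longrightarrow> br x (y + y') = br x y + br x y'"
    and br_scale_left: "\<lbrakk>x \<in> span (V 0 \<union> V 1); y \<in> span (V 0 \<union> V 1)\<rbrakk>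
      \<Longrightarrow> br (scale a x) y = scale a (br x y)"
    and br_scale_right: "\<lbrakk>x \<in> span (V 0 \<union> V 1); y \<in> span (V 0 \<union> V 1)\<rbrakk>
      \<Longrightarrow> br x (scale a y) = scale a (br x y)"
    and super_skew: "x \<in> V p \<Longrightarrow> y \<in> V q \<Longrightarrow>
      br x y = scale (if p = 1 \<and> q = 1 then 1 else - 1) (br y x)"
    and super_jacobi: "x \<in> V p \<Longrightarrow> y \<in> V q \<Longrightarrow> z \<in> V s \<Longrightarrow>
      br x (br y z) = br (br x y) z + scale (if p = 1 \<and> q = 1 then - 1 else 1) (br y (br x z))"

lemma mscale_mult: "mscale c A ** B = mscale c (A ** B)" "A ** mscale c B = mscale c (A ** B)"
  by (simp_all add: mscale_def matrix_matrix_mult_def vec_eq_iff sum_distrib_left mult_ac)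

lemma hpart_hpart: "hpart p (hpart q A) = (if p = q then hpart q A else 0)"
  by (auto simp: hpart_def vec_eq_iff)

lemma hpart_add: "hpart p (A + B) = hpart p A + hpart p B"
  by (auto simp: hpart_def vec_eq_iff)

lemma hpart_mscale: "hpart p (mscale a B) = mscale a (hpart p B)"
  by (auto simp: hpart_def vec_eq_iff mscale_def)

lemma sbracket_homogeneous:
  assumes "hpart p A = A" "hpart q B = B"
  shows "sbracket A B = A ** B - mscale (if p = 1 \<and> q = 1 then - 1 else 1) (B ** A)"
proof -
  have "hpart r A = (if r = p then A else 0)" for r using hpart_hpart[of r p A] assms by simp
  moreover have "hpart r B = (if r = q then B else 0)" for r using hpart_hpart[of r q B] assms by simp
  ultimately show ?thesis
    by (cases p; cases q; simp add: sbracket_def)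
qed

lemma hpart_mult: assumes "hpart p A = A" "hpart q B = B"
  shows "hpart (p + q) (A ** B) = A ** B"
proof -
  have A: "A $ i $ j = 0" if "parity i + parity j \<noteq> p" for i j 
    using that arg_cong[OF assms(1), of "\<lambda>A. A $ i $ j"] by (auto simp: hpart_def)
  have B: "B $ i $ j = 0" if "parity i + parity j \<noteq> q" for i j 
    using that arg_cong[OF assms(2), of "\<lambda>A. A $ i $ j"] by (auto simp: hpart_def)
  have "(A ** B) $ i $ j = 0" if "parity i + parity j \<noteq> p + q" for i j 
  proof -
    have "A $ i $ k * B $ k $ j = 0" for k
      using A[of i k] B[of k j] that by (cases "parity i"; cases "parity j"; cases "parity k"; cases p; cases q) auto
    thus ?thesis unfolding matrix_matrix_mult_def by (simp only: vec_lambda_beta sum.neutral_const)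
  qed
  thus ?thesis by (auto simp: hpart_def vec_eq_iff)
qed

lemma supertrace_sbracket: assumes "hpart p A = A" "hpart q B = B" shows "supertrace (sbracket A B) = 0"
proof -
  have A: "A $ i $ j = 0" if "parity i + parity j \<noteq> p" for i j 
    using that arg_cong[OF assms(1), of "\<lambda>A. A $ i $ j"] by (auto simp: hpart_def)
  have B: "B $ i $ j = 0" if "parity i + parity j \<noteq> q" for i j 
    using that arg_cong[OF assms(2), of "\<lambda>A. A $ i $ j"] by (auto simp: hpart_def)
  show ?thesis unfolding sbracket_homogeneous[OF assms]
    apply (cases p; cases q)
    by (simp_all add: supertrace_def matrix_matrix_mult_def mscale_def sum_sum_type sum_2 A B algebra_simps)
qed

lemma mat5_mult_diff: "(A::mat5) ** (B - C) = A ** B - A ** C" "(B - C) ** A = B ** A - C ** A"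
  by (simp_all add: matrix_matrix_mult_def vec_eq_iff algebra_simps sum_subtractf)

lemma mat5_mult_minus: "mscale (-1) A = - A" "(- A) ** B = - (A ** (B::mat5))" "A ** (- B) = - (A ** (B::mat5))"
  by (simp_all add: mscale_def matrix_matrix_mult_def vec_eq_iff sum_negf)

lemma mat5_add_mult: "((B::mat5) + C) ** A = B ** A + C ** A"
  by (simp add: matrix_matrix_mult_def vec_eq_iff algebra_simps sum.distrib)

lemma supertrace_add: "supertrace (A+B) = supertrace A + supertrace B" by (simp add: supertrace_def sum.distrib)

lemma supertrace_mscale: "supertrace (mscale a A) = a * supertrace A" by (simp add: supertrace_def mscale_def sum_distrib_left algebra_simps)

lemma sl41_lie_superalgebra: "lie_superalgebra mscale sl41_part sbracket"
proof unfold_locales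
  fix p show "cmat.subspace (sl41_part p)"
    by (auto simp: cmat.subspace_def sl41_part_def sl41_def hpart_add hpart_mscale supertrace_add supertrace_mscale) (auto simp: supertrace_def hpart_def vec_eq_iff)
next
  show "sl41_part 0 \<inter> sl41_part 1 = {0}"
    apply (auto simp: sl41_part_def sl41_def ) 
      apply (metis hpart_hpart zero_neq_one)
     by (auto simp: supertrace_def hpart_def vec_eq_iff)
next
  fix x y p q assume "x \<in> sl41_part p" "y \<in> sl41_part q"
  then have x: "hpart p x = x" "hpart q y = y" by (auto simp: sl41_part_def)
  show "sbracket x y \<in> sl41_part (p+q)" 
    using supertrace_sbracket[OF x] hpart_mult[OF x] hpart_mult[OF x(2,1)] apply (auto simp: sl41_part_def sl41_def)
    apply (auto simp: sbracket_homogeneous[OF x] hpart_add hpart_mscale add.commute diff_conv_add_uminus mat5_mult_minus simp del: add_uminus_conv_diff)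
     by (metis hpart_mscale mat5_mult_minus(1))+
  show "sbracket x y = mscale (if p = 1 \<and> q = 1 then 1 else - 1) (sbracket y x)"
    by (auto simp: sbracket_homogeneous[OF x] sbracket_homogeneous[OF x(2,1)] mat5_mult_minus)
  fix z s assume "z \<in> sl41_part s"
  then have z: "hpart s z = z" by (auto simp: sl41_part_def)
  have c: "hpart (p+q) (sbracket x y) = sbracket x y" if "hpart p x = x" "hpart q y = y" for p q x y
    using hpart_mult[OF that] hpart_mult[OF that(2,1)] that
    apply (auto simp: sbracket_homogeneous[OF that] hpart_add hpart_mscale add.commute diff_conv_add_uminus mat5_mult_minus simp del: add_uminus_conv_diff)
     by (metis hpart_mscale mat5_mult_minus(1))+
  show "sbracket x (sbracket y z) = sbracket (sbracket x y) z + mscale (if p = 1 \<and> q = 1 then - 1 else 1) (sbracket y (sbracket x z))"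
    unfolding sbracket_homogeneous[OF x(1) c[OF x(2) z]] sbracket_homogeneous[OF c[OF x] z]
      sbracket_homogeneous[OF x(2) c[OF x(1) z]]
    unfolding sbracket_homogeneous[OF x] sbracket_homogeneous[OF x(1) z] sbracket_homogeneous[OF x(2) z]
    by (cases p; cases q; cases s; simp add: mat5_mult_minus mat5_mult_diff matrix_add_ldistrib mat5_add_mult matrix_mul_assoc)
qed (auto simp: sbracket_def hpart_add hpart_mscale mscale_mult matrix_add_ldistrib mat5_add_mult cmat.scale_right_distrib cmat.scale_right_diff_distrib)

locale translation_superalgebra = lie_superalgebra scale V br
  for scale :: "complex \<Rightarrow> 'v::ab_group_add \<Rightarrow> 'v"
    and V :: "bit \<Rightarrow> 'v set" and br :: "'v \<Rightarrow> 'v \<Rightarrow> 'v" +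
  fixes act :: "mat5 \<Rightarrow> 'v \<Rightarrow> 'v"
  assumes parts_lorentz_module: "lorentz_module scale (V p) act"
    and even_dim: "dim (V 0) = 4"
    and even_abelian: "x \<in> V 0 \<Longrightarrow> y \<in> V 0 \<Longrightarrow> br x y = 0"
    and even_odd_trivial: "x \<in> V 0 \<Longrightarrow> y \<in> V 1 \<Longrightarrow> br x y = 0"
    and odd_dim: "dim (V 1) = 4"
    and odd_iso: "lorentz_isomorphic scale (V 1) act D_sum_scale UNIV D_sum"
    and odd_symmetric: "x \<in> V 1 \<Longrightarrow> y \<in> V 1 \<Longrightarrow> br x y = br y x"
    and odd_equivariant: "X \<in> lorentz \<Longrightarrow> x \<in> V 1 \<Longrightarrow> y \<in> V 1 \<Longrightarrow>
      act X (br x y) = br (act X x) y + br x (act X y)"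
    and odd_nonzero: "\<exists>x\<in>V 1. \<exists>y\<in>V 1. br x y \<noteq> 0"

definition direct_sum_decomp :: "mat5 set \<Rightarrow> mat5 set \<Rightarrow> mat5 set \<Rightarrow> bool" where
  "direct_sum_decomp G P N \<longleftrightarrow>
     cmat.subspace P \<and> cmat.subspace N \<and> P \<inter> N = {0} \<and> G = {x + y | x y. x \<in> P \<and> y \<in> N}"

definition translation_complement :: "mat5 set \<Rightarrow> mat5 set \<Rightarrow> bool" where
  "translation_complement p n \<longleftrightarrow>
     sub_superalgebra n \<and> direct_sum_decomp sl41 p n \<and>
     translation_superalgebra mscale (\<lambda>k. n \<inter> sl41_part k) sbracket sbracket"

definition translation_p :: "mat5 set" where
  "translation_p = {blocks L 0 0 M R \<alpha> \<beta> 0 c | L M R \<alpha> \<beta> c. c = trace L + trace R}"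

definition translation_n :: "mat5 set" where
  "translation_n = {blocks 0 A \<gamma> 0 0 0 0 \<delta> 0 | A \<gamma> \<delta>. True}"

end

theory Submission
  imports Defs
begin

text \<open>
  For uniqueness, let \<open>p \<oplus> n\<close> be a decomposition as required. Comparing an even
  element \<open>y\<close> of \<open>n\<close> with \<open>(ad h)\<^sup>2 y\<close> for \<open>h = diag(1, -1, 0, 0, 0)\<close> kills its \<open>L\<close>, \<open>R\<close> and \<open>c\<close> blocks,
  because the difference lies in \<open>p \<inter> n = 0\<close>; commutativity of \<open>y\<close> with its \<open>sl\<^sub>2\<close>-translates then
  kills \<open>M\<close>. So the even part of \<open>n\<close> consists of the matrices with only an \<open>A\<close> block. Since the odd
  bracket is nonzero, by polarization some odd \<open>x \<in> n\<close> has \<open>[x, x] \<noteq> 0\<close>; all blocks of \<open>[x, x]\<close> but \<open>A\<close>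
  vanish, which forces \<open>\<alpha> = \<beta> = 0\<close> and \<open>\<gamma> \<noteq> 0 \<noteq> \<delta>\<close>. By \<open>sl\<^sub>2\<close>-irreducibility \<open>n\<close> contains the full
  \<open>\<gamma>\<close> and \<open>\<delta>\<close> blocks, so \<open>p\<close> meets them trivially. The Borel subalgebra contains one of each pair of
  opposite odd root vectors, so \<open>p\<close> contains the \<open>\<alpha>\<close> and \<open>\<beta>\<close> blocks, and nothing else that is odd.
\<close>

section \<open>Block calculus for matrices with blocks of sizes 2, 2, 1\<close>

lemma forall_idx: "(\<forall>i::idx. P i) \<longleftrightarrow> (\<forall>k. P (Inl (Inl k))) \<and> (\<forall>k. P (Inl (Inr k))) \<and> P (Inr 1)"
  by (metis (full_types) num1_eq1 old.sum.exhaust)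

definition outer :: "complex^2 \<Rightarrow> complex^2 \<Rightarrow> complex^2^2" where
  "outer u v = (\<chi> i j. u $ i * v $ j)"

lemma outer_zero [simp]: "outer 0 v = 0" "outer u 0 = 0"
  by (simp_all add: outer_def vec_eq_iff)

lemma outer_eq_0_iff: "outer u v = 0 \<longleftrightarrow> u = 0 \<or> v = 0"
  by (auto simp: outer_def vec_eq_iff)

text \<open>Bilinear, without complex conjugation: this is the product of a row block with a column
  block.\<close>

definition vdot :: "complex^2 \<Rightarrow> complex^2 \<Rightarrow> complex" where
  "vdot u v = (\<Sum>i\<in>UNIV. u $ i * v $ i)"

lemma vdot_zero [simp]: "vdot 0 v = 0" "vdot u 0 = 0"
  by (simp_all add: vdot_def)

lemma blocks_eq_iff: "blocks L A \<gamma> M R \<alpha> \<beta> \<delta> c = blocks L' A' \<gamma>' M' R' \<alpha>' \<beta>' \<delta>' c' \<longleftrightarrow>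
   L = L' \<and> A = A' \<and> \<gamma> = \<gamma>' \<and> M = M' \<and> R = R' \<and> \<alpha> = \<alpha>' \<and> \<beta> = \<beta>' \<and> \<delta> = \<delta>' \<and> c = c'"
  by (auto simp: blocks_def vec_eq_iff forall_idx)

lemma blocks_exhaust:
  obtains L A \<gamma> M R \<alpha> \<beta> \<delta> c where "x = blocks L A \<gamma> M R \<alpha> \<beta> \<delta> c"
proof -
  have "x = blocks (\<chi> i j. x $ Inl (Inl i) $ Inl (Inl j)) (\<chi> i j. x $ Inl (Inl i) $ Inl (Inr j))
    (\<chi> i. x $ Inl (Inl i) $ Inr 1)
    (\<chi> i j. x $ Inl (Inr i) $ Inl (Inl j)) (\<chi> i j. x $ Inl (Inr i) $ Inl (Inr j))
    (\<chi> i. x $ Inl (Inr i) $ Inr 1)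
    (\<chi> j. x $ Inr 1 $ Inl (Inl j)) (\<chi> j. x $ Inr 1 $ Inl (Inr j)) (x $ Inr 1 $ Inr 1)"
    by (simp add: blocks_def vec_eq_iff forall_idx)
  with that show thesis by blast
qed

text \<open>Having the form of an induction rule, it lets \<open>induct\<close> put the block form
  directly into the goal and the chained facts, with no equation for \<open>x\<close> left
  over.\<close>

lemma blocks_induct [case_names blocks]:
  "(\<And>L A \<gamma> M R \<alpha> \<beta> \<delta> c. P (blocks L A \<gamma> M R \<alpha> \<beta> \<delta> c)) \<Longrightarrow> P x"
  by (cases x rule: blocks_exhaust) simp

lemma blocks_nth: "blocks L A \<gamma> M R \<alpha> \<beta> \<delta> c $ i $ j = block_entry L A \<gamma> M R \<alpha> \<beta> \<delta> c i j"
  by (simp add: blocks_def)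

lemma blocks_add: "blocks L A \<gamma> M R \<alpha> \<beta> \<delta> c + blocks L' A' \<gamma>' M' R' \<alpha>' \<beta>' \<delta>' c' =
   blocks (L + L') (A + A') (\<gamma> + \<gamma>') (M + M') (R + R') (\<alpha> + \<alpha>') (\<beta> + \<beta>') (\<delta> + \<delta>') (c + c')"
  by (auto simp: blocks_def vec_eq_iff forall_idx)

lemma blocks_diff: "blocks L A \<gamma> M R \<alpha> \<beta> \<delta> c - blocks L' A' \<gamma>' M' R' \<alpha>' \<beta>' \<delta>' c' =
   blocks (L - L') (A - A') (\<gamma> - \<gamma>') (M - M') (R - R') (\<alpha> - \<alpha>') (\<beta> - \<beta>') (\<delta> - \<delta>') (c - c')"
  by (auto simp: blocks_def vec_eq_iff forall_idx)

lemma blocks_zero: "blocks 0 0 0 0 0 0 0 0 0 = 0"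
  by (auto simp: blocks_def vec_eq_iff forall_idx)

lemma blocks_eq_0_iff: "blocks L A \<gamma> M R \<alpha> \<beta> \<delta> c = 0 \<longleftrightarrow>
   L = 0 \<and> A = 0 \<and> \<gamma> = 0 \<and> M = 0 \<and> R = 0 \<and> \<alpha> = 0 \<and> \<beta> = 0 \<and> \<delta> = 0 \<and> c = 0"
  by (simp add: blocks_eq_iff flip: blocks_zero)

lemma mscale_blocks: "mscale k (blocks L A \<gamma> M R \<alpha> \<beta> \<delta> c) =
   blocks (\<chi> i. k *s L $ i) (\<chi> i. k *s A $ i) (k *s \<gamma>) (\<chi> i. k *s M $ i) (\<chi> i. k *s R $ i)
     (k *s \<alpha>) (k *s \<beta>) (k *s \<delta>) (k * c)"
  by (auto simp: blocks_def mscale_def vec_eq_iff forall_idx)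

lemma blocks_mult: "blocks L A \<gamma> M R \<alpha> \<beta> \<delta> c ** blocks L' A' \<gamma>' M' R' \<alpha>' \<beta>' \<delta>' c' =
   blocks (L ** L' + A ** M' + outer \<gamma> \<beta>') (L ** A' + A ** R' + outer \<gamma> \<delta>')
     (L *v \<gamma>' + A *v \<alpha>' + c' *s \<gamma>)
     (M ** L' + R ** M' + outer \<alpha> \<beta>') (M ** A' + R ** R' + outer \<alpha> \<delta>')
     (M *v \<gamma>' + R *v \<alpha>' + c' *s \<alpha>)
     (\<beta> v* L' + \<delta> v* M' + c *s \<beta>') (\<beta> v* A' + \<delta> v* R' + c *s \<delta>')
     (vdot \<beta> \<gamma>' + vdot \<delta> \<alpha>' + c * c')"
  by (simp add: vec_eq_iff forall_idx blocks_def matrix_matrix_mult_def matrix_vector_mult_def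
      vector_matrix_mult_def outer_def vdot_def sum_sum_type mult_ac)

lemma hpart_blocks:
  "hpart 0 (blocks L A \<gamma> M R \<alpha> \<beta> \<delta> c) = blocks L A 0 M R 0 0 0 c"
  "hpart 1 (blocks L A \<gamma> M R \<alpha> \<beta> \<delta> c) = blocks 0 0 \<gamma> 0 0 \<alpha> \<beta> \<delta> 0"
  by (simp_all add: hpart_def blocks_def vec_eq_iff forall_idx)

lemma supertrace_blocks: "supertrace (blocks L A \<gamma> M R \<alpha> \<beta> \<delta> c) = trace L + trace R - c"
  by (simp add: supertrace_def blocks_def sum_sum_type trace_def)

lemma blocks_in_sl41_iff: "blocks L A \<gamma> M R \<alpha> \<beta> \<delta> c \<in> sl41 \<longleftrightarrow> c = trace L + trace R"
  by (auto simp: sl41_def supertrace_blocks)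

lemma blocks_in_sl41_part_iff:
  "blocks L A \<gamma> M R \<alpha> \<beta> \<delta> c \<in> sl41_part 0 \<longleftrightarrow>
     c = trace L + trace R \<and> \<gamma> = 0 \<and> \<alpha> = 0 \<and> \<beta> = 0 \<and> \<delta> = 0"
  "blocks L A \<gamma> M R \<alpha> \<beta> \<delta> c \<in> sl41_part 1 \<longleftrightarrow> L = 0 \<and> A = 0 \<and> M = 0 \<and> R = 0 \<and> c = 0"
  by (auto simp: sl41_part_def blocks_in_sl41_iff hpart_blocks blocks_eq_iff trace_def)

lemma blocks_in_translation_p_iff: "blocks L A \<gamma> M R \<alpha> \<beta> \<delta> c \<in> translation_p \<longleftrightarrow>
    c = trace L + trace R \<and> A = 0 \<and> \<gamma> = 0 \<and> \<delta> = 0"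
  by (auto simp: translation_p_def blocks_eq_iff)

lemma blocks_in_translation_n_iff: "blocks L A \<gamma> M R \<alpha> \<beta> \<delta> c \<in> translation_n \<longleftrightarrow>
    L = 0 \<and> M = 0 \<and> R = 0 \<and> \<alpha> = 0 \<and> \<beta> = 0 \<and> c = 0"
  by (auto simp: translation_n_def blocks_eq_iff)

lemma blocks_in_parabolic_even_iff: "blocks L A \<gamma> M R \<alpha> \<beta> \<delta> c \<in> parabolic_even \<longleftrightarrow>
    c = trace L + trace R \<and> A = 0 \<and> \<gamma> = 0 \<and> \<alpha> = 0 \<and> \<beta> = 0 \<and> \<delta> = 0"
  by (auto simp: parabolic_even_def blocks_in_sl41_part_iff blocks_eq_iff)

section \<open>Homogeneous components, sub-superalgebras and bilinearity of the bracket\<close>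

lemma sl41_part_subset: "sl41_part k \<subseteq> sl41"
  by (auto simp: sl41_part_def)

lemma even_plus_odd: "x = hpart 0 x + hpart 1 x"
  by (cases x rule: blocks_exhaust) (simp add: hpart_blocks blocks_add)

lemma hpart_in_sl41_part: "x \<in> sl41 \<Longrightarrow> hpart k x \<in> sl41_part k"
  by (cases x rule: blocks_exhaust; cases k)
     (auto simp: hpart_blocks blocks_in_sl41_iff blocks_in_sl41_part_iff)

text \<open>The even and odd summands of an element are unique and are recovered by
  \<open>hpart\<close>, so being graded amounts to closure under both projections, a condition that
  can be checked on blocks.\<close>

lemma sub_superalgebra_iff: "sub_superalgebra S \<longleftrightarrow>
  S \<subseteq> sl41 \<and> cmat.subspace S \<and> (\<forall>x\<in>S. \<forall>k. hpart k x \<in> S) \<and> (\<forall>x\<in>S. \<forall>y\<in>S. sbracket x y \<in> S)"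
proof -
  have "S = {x + y | x y. x \<in> S \<inter> sl41_part 0 \<and> y \<in> S \<inter> sl41_part 1} \<longleftrightarrow> (\<forall>x\<in>S. \<forall>k. hpart k x \<in> S)"
    (is "?L \<longleftrightarrow> ?R") if S: "S \<subseteq> sl41" "cmat.subspace S"
  proof
    assume L: ?L
    show ?R
    proof (intro ballI allI)
      fix x k assume "x \<in> S"
      then obtain y z where "x = y + z" and yz: "y \<in> S" "z \<in> S" "y \<in> sl41_part 0" "z \<in> sl41_part 1"
        using L by blast
      moreover have "hpart 0 (y + z) = y" "hpart 1 (y + z) = z"
        using yz hpart_hpart[of 0 1 z] hpart_hpart[of 1 0 y] by (auto simp: hpart_add sl41_part_def)
      ultimately show "hpart k x \<in> S" by (cases k) auto
    qed
  next
    assume R: ?R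
    show ?L
    proof (intro equalityI subsetI)
      fix x assume x: "x \<in> S"
      then have "hpart k x \<in> S \<inter> sl41_part k" for k
        using R S(1) hpart_in_sl41_part by auto
      then show "x \<in> {x + y | x y. x \<in> S \<inter> sl41_part 0 \<and> y \<in> S \<inter> sl41_part 1}"
        using even_plus_odd[of x] by blast
    qed (use S(2) cmat.subspace_add in auto)
  qed
  then show ?thesis by (auto simp: sub_superalgebra_def)
qed

lemma sbracket_add:
  "sbracket (x + x') y = sbracket x y + sbracket x' y"
  "sbracket x (y + y') = sbracket x y + sbracket x y'"
  by (simp_all add: sbracket_def hpart_add matrix_add_ldistrib mat5_add_mult)

lemma sbracket_mscale:
  "sbracket (mscale a x) y = mscale a (sbracket x y)"
  "sbracket x (mscale a y) = mscale a (sbracket x y)"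
  by (simp_all add: sbracket_def hpart_mscale mscale_mult cmat.scale_right_distrib
      cmat.scale_right_diff_distrib)

text \<open>Expanding both arguments into homogeneous components reduces the claim to
  \<open>supertrace_sbracket\<close>.\<close>

lemma sbracket_in_sl41: "sbracket x y \<in> sl41"
proof -
  have "sbracket x y = sbracket (hpart 0 x) (hpart 0 y) + sbracket (hpart 0 x) (hpart 1 y)
      + sbracket (hpart 1 x) (hpart 0 y) + sbracket (hpart 1 x) (hpart 1 y)"
    by (simp add: sbracket_def hpart_hpart)
  moreover have "supertrace (sbracket (hpart i x) (hpart j y)) = 0" for i j
    by (rule supertrace_sbracket[of i _ j]) (simp_all add: hpart_hpart)
  ultimately show ?thesis
    by (simp add: sl41_def supertrace_add)
qed

section \<open>The two explicit sub-superalgebras\<close>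

lemma sub_superalgebra_translation_p: "sub_superalgebra translation_p"
  unfolding sub_superalgebra_iff
proof (intro conjI ballI allI)
  show "translation_p \<subseteq> sl41" by (auto simp: translation_p_def blocks_in_sl41_iff)
  show "cmat.subspace translation_p"
    unfolding cmat.subspace_def
    by (auto simp: translation_p_def mscale_blocks blocks_add blocks_eq_iff trace_add simp flip: blocks_zero)
       (auto simp: trace_def vec_eq_iff algebra_simps sum_distrib_left)
  show "hpart k x \<in> translation_p" if "x \<in> translation_p" for x k
    using that by (cases x rule: blocks_exhaust; cases k)
      (auto simp: hpart_blocks blocks_in_translation_p_iff trace_def)
  show "sbracket x y \<in> translation_p" if "x \<in> translation_p" "y \<in> translation_p" for x y
  proof -
    from that obtain L M R \<alpha> \<beta> c L' M' R' \<alpha>' \<beta>' c'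
      where "x = blocks L 0 0 M R \<alpha> \<beta> 0 c" "y = blocks L' 0 0 M' R' \<alpha>' \<beta>' 0 c'"
      unfolding translation_p_def by blast
    \<comment> \<open>Only the three zero blocks have to be computed; the condition on the corner
      entry follows from the vanishing supertrace of a bracket.\<close>
    then have "\<exists>L M R \<alpha> \<beta> c. sbracket x y = blocks L 0 0 M R \<alpha> \<beta> 0 c"
      by (simp add: sbracket_def hpart_blocks blocks_mult blocks_add blocks_diff blocks_eq_iff)
    then show ?thesis
      using sbracket_in_sl41[of x y] by (auto simp: blocks_in_sl41_iff blocks_in_translation_p_iff)
  qed
qed

lemma sub_superalgebra_translation_n: "sub_superalgebra translation_n"
  unfolding sub_superalgebra_iff
proof (intro conjI ballI allI)
  show "translation_n \<subseteq> sl41" by (auto simp: translation_n_def blocks_in_sl41_iff trace_def)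
  show "cmat.subspace translation_n"
    unfolding cmat.subspace_def
    by (auto simp: translation_n_def mscale_blocks blocks_add blocks_eq_iff simp flip: blocks_zero)
       (auto simp: vec_eq_iff)
  show "hpart k x \<in> translation_n" if "x \<in> translation_n" for x k
    using that by (cases x rule: blocks_exhaust; cases k)
      (auto simp: hpart_blocks blocks_in_translation_n_iff)
  show "sbracket x y \<in> translation_n" if "x \<in> translation_n" "y \<in> translation_n" for x y
    using that by (cases x rule: blocks_exhaust; cases y rule: blocks_exhaust)
      (auto simp: sbracket_def hpart_blocks blocks_mult blocks_add blocks_diff
        blocks_in_translation_n_iff)
qed

lemma lie_superalgebra_sub_superalgebra:
  assumes "sub_superalgebra S"
  shows "lie_superalgebra mscale (\<lambda>k. S \<inter> sl41_part k) sbracket"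
proof -
  interpret g: lie_superalgebra mscale sl41_part sbracket by (rule sl41_lie_superalgebra)
  show ?thesis
  proof unfold_locales
    show "cmat.subspace (S \<inter> sl41_part k)" for k
      using assms g.part_subspace cmat.subspace_inter by (auto simp: sub_superalgebra_def)
    show "S \<inter> sl41_part 0 \<inter> (S \<inter> sl41_part 1) = {0}"
      using assms g.parts_independent cmat.subspace_0 by (auto simp: sub_superalgebra_def)
    show "sbracket x y \<in> S \<inter> sl41_part (a + b)"
      if "x \<in> S \<inter> sl41_part a" "y \<in> S \<inter> sl41_part b" for x y a b
      using assms g.br_closed that by (auto simp: sub_superalgebra_def)
    show "sbracket x y = mscale (if a = 1 \<and> b = 1 then 1 else - 1) (sbracket y x)"
      if "x \<in> S \<inter> sl41_part a" "y \<in> S \<inter> sl41_part b" for x y a b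
      using g.super_skew that by blast
    show "sbracket x (sbracket y z) = sbracket (sbracket x y) z
        + mscale (if a = 1 \<and> b = 1 then - 1 else 1) (sbracket y (sbracket x z))"
      if "x \<in> S \<inter> sl41_part a" "y \<in> S \<inter> sl41_part b" "z \<in> S \<inter> sl41_part c" for x y z a b c
      using g.super_jacobi that by blast
  qed (simp_all add: sbracket_add sbracket_mscale)
qed

section \<open>The adjoint action of the Lorentz algebra\<close>

lemma lorentz_subset: "lorentz \<subseteq> sl41_part 0"
  by (auto simp: lorentz_def blocks_in_sl41_part_iff)

text \<open>No sign arises when one argument is even, so the ordinary commutator is correct even for
  a \<open>Y\<close> of mixed parity.\<close>

lemma sbracket_even: "X \<in> sl41_part 0 \<Longrightarrow> sbracket X Y = X ** Y - Y ** X"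
  by (cases X rule: blocks_exhaust; cases Y rule: blocks_exhaust)
     (simp add: sbracket_def hpart_blocks blocks_in_sl41_part_iff blocks_mult blocks_add blocks_diff)

text \<open>This displays the module structure of each block: \<gamma> and \<alpha> are the standard
  modules of the first and second factor, \<beta> and \<delta> are their duals, and A and M are
  spaces of linear maps between the standard modules.\<close>

lemma sbracket_lorentz: 
  assumes "trace X = 0" "trace Y = 0"
  shows "sbracket (blocks X 0 0 0 Y 0 0 0 0) (blocks L A \<gamma> M R \<alpha> \<beta> \<delta> c) =
    blocks (X ** L - L ** X) (X ** A - A ** Y) (X *v \<gamma>) (Y ** M - M ** X) (Y ** R - R ** Y)
      (Y *v \<alpha>) (- (\<beta> v* X)) (- (\<delta> v* Y)) 0"
  using assms by (simp add: sbracket_even blocks_in_sl41_part_iff blocks_mult blocks_diff)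

text \<open>The representation law is the super Jacobi identity with two even arguments; that
  identity is available for homogeneous elements, hence the single parity \<open>k\<close>.\<close>

lemma lorentz_module_adjoint:
  assumes "cmat.subspace S" "S \<subseteq> sl41_part k" "\<And>X v. X \<in> lorentz \<Longrightarrow> v \<in> S \<Longrightarrow> sbracket X v \<in> S"
  shows "lorentz_module mscale S sbracket"
proof
  fix X Y v assume XY: "X \<in> lorentz" "Y \<in> lorentz" and v: "v \<in> S"
  interpret g: lie_superalgebra mscale sl41_part sbracket by (rule sl41_lie_superalgebra)
  have "X ** Y - Y ** X = sbracket X Y"
    using XY lorentz_subset by (simp add: sbracket_even subset_iff)
  moreover have "sbracket X (sbracket Y v) = sbracket (sbracket X Y) v + sbracket Y (sbracket X v)"
    using g.super_jacobi[of X 0 Y 0 v k] XY v assms(2) lorentz_subset by auto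
  ultimately show "sbracket (X ** Y - Y ** X) v = sbracket X (sbracket Y v) - sbracket Y (sbracket X v)"
    by simp
qed (use assms in \<open>simp_all add: sbracket_add sbracket_mscale\<close>)

section \<open>The structure of a translation superalgebra on \<open>translation_n\<close>\<close>

lemma vector_nth_2: "vector [v $ 1, v $ 2] = (v :: complex^2)"
  by (simp add: vec_eq_iff forall_2)

text \<open>The matrix units at the positions in \<open>T\<close> form a basis.\<close>

lemma dim_supported: "cmat.dim {A :: mat5. \<forall>i j. (i, j) \<notin> T \<longrightarrow> A $ i $ j = 0} = card T"
proof -
  define e :: "idx \<times> idx \<Rightarrow> mat5" where "e p = (\<chi> i j. if (i, j) = p then 1 else 0)" for p
  have e_nth: "e p $ i $ j = (if (i, j) = p then 1 else 0)" for p i j by (simp add: e_def)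
  have "inj e"
    by (rule injI) (metis e_nth surj_pair zero_neq_one)
  then have inj: "inj_on e T" by (rule inj_on_subset) simp
  have sum_nth: "(\<Sum>p\<in>T. mscale (f p) (e p)) $ i $ j = (if (i, j) \<in> T then f (i, j) else 0)" for f i j
    by (simp add: mscale_def e_nth if_distrib[of "\<lambda>x. _ * x"] sum.delta' cong: if_cong)
  show ?thesis
  proof (rule cmat.dim_unique)
    show "e ` T \<subseteq> {A. \<forall>i j. (i, j) \<notin> T \<longrightarrow> A $ i $ j = 0}"
      by (auto simp: e_nth)
    show "{A. \<forall>i j. (i, j) \<notin> T \<longrightarrow> A $ i $ j = 0} \<subseteq> cmat.span (e ` T)"
    proof
      fix A :: mat5 assume "A \<in> {A. \<forall>i j. (i, j) \<notin> T \<longrightarrow> A $ i $ j = 0}"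
      then have "A = (\<Sum>p\<in>T. mscale (A $ fst p $ snd p) (e p))"
        by (simp add: vec_eq_iff sum_nth del: sum_component)
      also have "\<dots> \<in> cmat.span (e ` T)"
        by (intro cmat.span_sum cmat.span_scale cmat.span_base imageI)
      finally show "A \<in> cmat.span (e ` T)" .
    qed
    show "cmat.independent (e ` T)"
    proof (rule cmat.independent_if_scalars_zero)
      fix f x assume sum: "(\<Sum>x\<in>e ` T. mscale (f x) x) = 0" and "x \<in> e ` T"
      then obtain i j where ij: "(i, j) \<in> T" "x = e (i, j)" by auto
      have "(\<Sum>p\<in>T. mscale (f (e p)) (e p)) = 0"
        using sum inj by (simp add: sum.reindex)
      then have "(\<Sum>p\<in>T. mscale (f (e p)) (e p)) $ i $ j = 0"
        by (simp del: sum_component)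
      then show "f x = 0" using ij by (simp add: sum_nth del: sum_component)
    qed simp
    show "card (e ` T) = card T" using inj by (rule card_image)
  qed
qed

text \<open>Written as a support condition, the space has a dimension that
  \<open>dim_supported\<close> reads off by counting positions; \<open>translation_n_odd\<close>
  serves the same purpose.\<close>

lemma translation_n_even: "translation_n \<inter> sl41_part 0 =
  {x. \<forall>i j. (i, j) \<notin> range (Inl \<circ> Inl) \<times> range (Inl \<circ> Inr) \<longrightarrow> x $ i $ j = 0}"
proof (rule set_eqI)
  show "x \<in> translation_n \<inter> sl41_part 0 \<longleftrightarrow> x \<in>
    {x. \<forall>i j. (i, j) \<notin> range (Inl \<circ> Inl) \<times> range (Inl \<circ> Inr) \<longrightarrow> x $ i $ j = 0}" for x
    by (induct x rule: blocks_induct)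
       (auto simp: blocks_in_translation_n_iff blocks_in_sl41_part_iff forall_idx image_iff
          blocks_nth vec_eq_iff trace_def)
qed

lemma translation_n_odd: "translation_n \<inter> sl41_part 1 =
  {x. \<forall>i j. (i, j) \<notin> range (Inl \<circ> Inl) \<times> {Inr 1} \<union> {Inr 1} \<times> range (Inl \<circ> Inr) \<longrightarrow> x $ i $ j = 0}"
proof (rule set_eqI)
  show "x \<in> translation_n \<inter> sl41_part 1 \<longleftrightarrow> x \<in>
    {x. \<forall>i j. (i, j) \<notin> range (Inl \<circ> Inl) \<times> {Inr 1} \<union> {Inr 1} \<times> range (Inl \<circ> Inr) \<longrightarrow> x $ i $ j = 0}" for x
    by (induct x rule: blocks_induct)
       (auto simp: blocks_in_translation_n_iff blocks_in_sl41_part_iff forall_idx image_iff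
          blocks_nth vec_eq_iff)
qed

lemma card_range_idx: "card (range (Inl \<circ> Inl :: 2 \<Rightarrow> idx)) = 2" "card (range (Inl \<circ> Inr :: 2 \<Rightarrow> idx)) = 2"
  by (subst card_image; simp add: inj_compose)+

lemma dim_translation_n: "cmat.dim (translation_n \<inter> sl41_part k) = 4"
proof (cases k)
  case zero
  then show ?thesis
    unfolding zero translation_n_even dim_supported by (simp add: card_cartesian_product card_range_idx del: o_apply)
next
  case one
  have "card (range (Inl \<circ> Inl :: 2 \<Rightarrow> idx) \<times> {Inr 1 :: idx} \<union> {Inr 1 :: idx} \<times> range (Inl \<circ> Inr :: 2 \<Rightarrow> idx)) = 4"
  proof (subst card_Un_disjoint)
    show "range (Inl \<circ> Inl :: 2 \<Rightarrow> idx) \<times> {Inr 1} \<inter> {Inr 1} \<times> range (Inl \<circ> Inr) = {}" by auto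
  qed (simp_all add: card_cartesian_product card_range_idx del: o_apply)
  then show ?thesis
    unfolding one translation_n_odd dim_supported .
qed

lemma lorentz_closed_translation_n:
  assumes "X \<in> lorentz" "v \<in> translation_n \<inter> sl41_part k"
  shows "sbracket X v \<in> translation_n \<inter> sl41_part k"
proof -
  interpret g: lie_superalgebra mscale sl41_part sbracket by (rule sl41_lie_superalgebra)
  have "sbracket X v \<in> sl41_part k"
    using g.br_closed[of X 0 v k] assms lorentz_subset by (cases k) auto
  moreover have "sbracket X v \<in> translation_n"
    using assms by (auto simp: lorentz_def translation_n_def sbracket_lorentz blocks_eq_iff)
  ultimately show ?thesis by simp
qed

lemma lorentz_isomorphic_translation_n_odd:
  "lorentz_isomorphic mscale (translation_n \<inter> sl41_part 1) sbracket D_sum_scale UNIV D_sum"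
proof -
  \<comment> \<open>The dual of the two-dimensional \<open>sl\<^sub>2\<close>-module is identified with the module itself by
    \<open>(a, b) \<mapsto> (b, - a)\<close>.\<close>
  define f :: "mat5 \<Rightarrow> (complex^2) \<times> (complex^2)" where
    "f x = ((\<chi> i. x $ Inl (Inl i) $ Inr 1), vector [x $ Inr 1 $ Inl (Inr 2), - x $ Inr 1 $ Inl (Inr 1)])" for x
  define g :: "(complex^2) \<times> (complex^2) \<Rightarrow> mat5" where
    "g uv = blocks 0 0 (fst uv) 0 0 0 0 (vector [- snd uv $ 2, snd uv $ 1]) 0" for uv
  have f: "f (blocks L A \<gamma> M R \<alpha> \<beta> \<delta> c) = (\<gamma>, vector [\<delta> $ 2, - \<delta> $ 1])" for L A \<gamma> M R \<alpha> \<beta> \<delta> c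
    by (simp add: f_def blocks_nth vec_eq_iff)
  have "bij_betw f (translation_n \<inter> sl41_part 1) UNIV"
  proof (rule bij_betwI[where g = g])
    show "g (f x) = x" if "x \<in> translation_n \<inter> sl41_part 1" for x
      using that by (induct x rule: blocks_induct)
        (simp add: f g_def blocks_in_translation_n_iff blocks_in_sl41_part_iff blocks_eq_iff
          vector_nth_2)
  qed (auto simp: f g_def blocks_in_translation_n_iff blocks_in_sl41_part_iff vec_eq_iff forall_2)
  moreover have "f (v + w) = f v + f w" for v w
    by (simp add: f_def vec_eq_iff forall_2)
  moreover have "f (mscale a v) = D_sum_scale a (f v)" for v a
    by (simp add: f_def D_sum_scale_def mscale_def vec_eq_iff forall_2)
  moreover have "f (sbracket X v) = D_sum X (f v)" if "X \<in> lorentz" for X v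
  proof -
    from that obtain L R where X: "X = blocks L 0 0 0 R 0 0 0 0" and tr: "trace L = 0" "trace R = 0"
      by (auto simp: lorentz_def)
    from tr(2) have R22: "R $ 2 $ 2 = - R $ 1 $ 1"
      by (simp add: trace_def sum_2 eq_neg_iff_add_eq_0 add.commute)
    \<comment> \<open>The trace condition enters here: the map
      \<open>(a, b) \<mapsto> (b, - a)\<close> conjugates \<open>- transpose R\<close> into
      \<open>R\<close> exactly when \<open>trace R = 0\<close>.\<close>
    have "vector [(- (\<delta> v* R)) $ 2, - (- (\<delta> v* R)) $ 1] = R *v vector [\<delta> $ 2, - \<delta> $ 1]" for \<delta>
      by (simp add: vec_eq_iff forall_2 matrix_vector_mult_def vector_matrix_mult_def sum_2 R22 mult_ac)
    then show ?thesis
      unfolding X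
      by (induct v rule: blocks_induct)
         (simp add: sbracket_lorentz tr f D_sum_def D_half_0_blocks D_0_half_blocks)
  qed
  ultimately show ?thesis
    unfolding lorentz_isomorphic_def by blast
qed

lemma translation_superalgebra_translation_n:
  "translation_superalgebra mscale (\<lambda>k. translation_n \<inter> sl41_part k) sbracket sbracket"
proof -
  interpret g: lie_superalgebra mscale sl41_part sbracket by (rule sl41_lie_superalgebra)
  interpret lie_superalgebra mscale "\<lambda>k. translation_n \<inter> sl41_part k" sbracket
    by (intro lie_superalgebra_sub_superalgebra sub_superalgebra_translation_n)
  show ?thesis
  proof (intro translation_superalgebra.intro translation_superalgebra_axioms.intro)
    fix k show "lorentz_module mscale (translation_n \<inter> sl41_part k) sbracket"
      by (rule lorentz_module_adjoint[OF part_subspace _ lorentz_closed_translation_n]) auto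
  next
    show "cmat.dim (translation_n \<inter> sl41_part 0) = 4" "cmat.dim (translation_n \<inter> sl41_part 1) = 4"
      by (rule dim_translation_n)+
  next
    fix x y assume x: "x \<in> translation_n \<inter> sl41_part 0"
    show "sbracket x y = 0" if "y \<in> translation_n \<inter> sl41_part 0"
      using x that by (induct x rule: blocks_induct; induct y rule: blocks_induct)
        (simp add: blocks_in_translation_n_iff blocks_in_sl41_part_iff sbracket_even blocks_mult blocks_diff blocks_zero)
    show "sbracket x y = 0" if "y \<in> translation_n \<inter> sl41_part 1"
      using x that by (induct x rule: blocks_induct; induct y rule: blocks_induct)
        (simp add: blocks_in_translation_n_iff blocks_in_sl41_part_iff sbracket_even blocks_mult blocks_diff blocks_zero)
  next
    fix x y assume xy: "x \<in> translation_n \<inter> sl41_part 1" "y \<in> translation_n \<inter> sl41_part 1"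
    show "sbracket x y = sbracket y x"
      using super_skew[OF xy] by simp
    fix X assume "X \<in> lorentz"
    \<comment> \<open>Equivariance is the super Jacobi identity with an even first argument.\<close>
    then show "sbracket X (sbracket x y) = sbracket (sbracket X x) y + sbracket x (sbracket X y)"
      using g.super_jacobi[of X 0 x 1 y 1] xy lorentz_subset by auto
  next
    \<comment> \<open>The square of an odd element of \<open>translation_n\<close> is twice the
      outer product of its \<gamma> and \<delta> blocks, so any two nonzero blocks give a
      witness.\<close>
    define x where "x = blocks 0 0 (axis 1 1) 0 0 0 0 (axis 1 1) 0"
    have "x \<in> translation_n \<inter> sl41_part 1"
      by (simp add: x_def blocks_in_translation_n_iff blocks_in_sl41_part_iff)
    moreover have "sbracket x x = blocks 0 (outer (axis 1 1) (axis 1 1) + outer (axis 1 1) (axis 1 1)) 0 0 0 0 0 0 0"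
      by (simp add: x_def sbracket_def hpart_blocks blocks_mult blocks_add blocks_diff blocks_zero)
    moreover have "outer (axis 1 1) (axis 1 1) + outer (axis 1 1) (axis 1 1) \<noteq> 0"
      by (simp add: vec_eq_iff forall_2 outer_def axis_def)
    ultimately show "\<exists>x\<in>translation_n \<inter> sl41_part 1. \<exists>y\<in>translation_n \<inter> sl41_part 1. sbracket x y \<noteq> 0"
      using blocks_eq_0_iff by metis
  qed (rule lorentz_isomorphic_translation_n_odd lie_superalgebra_axioms)+
qed

section \<open>Existence: the direct sum and a suitable Borel subalgebra\<close>

lemma translation_complement_translation_n: "translation_complement translation_p translation_n"
  unfolding translation_complement_def direct_sum_decomp_def
proof (intro conjI)
  show "translation_p \<inter> translation_n = {0}"
  proof (rule set_eqI)
    show "x \<in> translation_p \<inter> translation_n \<longleftrightarrow> x \<in> {0}" for x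
      by (induct x rule: blocks_induct)
         (auto simp: blocks_in_translation_p_iff blocks_in_translation_n_iff blocks_eq_0_iff trace_def)
  qed
  have sub: "translation_p \<subseteq> sl41" "translation_n \<subseteq> sl41"
    using sub_superalgebra_translation_p sub_superalgebra_translation_n
    by (auto simp: sub_superalgebra_def)
  show "sl41 = {x + y |x y. x \<in> translation_p \<and> y \<in> translation_n}"
  proof (intro equalityI subsetI)
    fix x assume x: "x \<in> sl41"
    obtain L A \<gamma> M R \<alpha> \<beta> \<delta> c where xb: "x = blocks L A \<gamma> M R \<alpha> \<beta> \<delta> c" by (rule blocks_exhaust)
    then have "x = blocks L 0 0 M R \<alpha> \<beta> 0 c + blocks 0 A \<gamma> 0 0 0 0 \<delta> 0" by (simp add: blocks_add)
    moreover have "blocks L 0 0 M R \<alpha> \<beta> 0 c \<in> translation_p" "blocks 0 A \<gamma> 0 0 0 0 \<delta> 0 \<in> translation_n"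
      using x xb by (simp_all add: blocks_in_sl41_iff blocks_in_translation_p_iff blocks_in_translation_n_iff)
    ultimately show "x \<in> {x + y |x y. x \<in> translation_p \<and> y \<in> translation_n}" by blast
  qed (use sub in \<open>auto simp: sl41_def supertrace_add subset_iff\<close>)
qed (use sub_superalgebra_translation_p sub_superalgebra_translation_n
    translation_superalgebra_translation_n in \<open>auto simp: sub_superalgebra_def\<close>)

lemma translation_p_even: "translation_p \<inter> sl41_part 0 = parabolic_even"
proof (rule set_eqI)
  show "x \<in> translation_p \<inter> sl41_part 0 \<longleftrightarrow> x \<in> parabolic_even" for x
    by (induct x rule: blocks_induct)
       (auto simp: blocks_in_translation_p_iff blocks_in_sl41_part_iff blocks_in_parabolic_even_iff)
qed

lemma parabolic_superalgebra_translation_p: "parabolic_superalgebra translation_p"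
proof -
  \<comment> \<open>The odd coordinate is inserted between the two pairs of even ones.\<close>
  define q :: "idx \<Rightarrow> nat" where
    "q i = (case i of Inl (Inl _) \<Rightarrow> position i | Inl (Inr _) \<Rightarrow> position i + 1 | Inr _ \<Rightarrow> 3)" for i
  define r where "r = {(i, j). q i \<le> q j}"
  have "inj q"
    unfolding inj_def by (auto simp: forall_idx forall_2 q_def)
  then have "linear_order r"
    by (auto simp: r_def linear_order_on_def partial_order_on_def preorder_on_def refl_on_def trans_def
        antisym_def total_on_def inj_def)
  then have "borel_subalgebra (borel_of r)" by (auto simp: borel_subalgebra_def)
  \<comment> \<open>On the four even coordinates \<open>q\<close> induces the same order as
    \<open>position\<close>, and an even matrix has no entries linking them to the odd
    coordinate.\<close>
  moreover have "borel_of r \<inter> sl41_part 0 = standard_borel_even"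
  proof (rule set_eqI)
    show "x \<in> borel_of r \<inter> sl41_part 0 \<longleftrightarrow> x \<in> standard_borel_even" for x
      using sl41_part_subset by (induct x rule: blocks_induct)
        (auto simp: borel_of_def standard_borel_even_def r_def q_def blocks_in_sl41_part_iff
          blocks_in_sl41_iff forall_idx forall_2 blocks_nth)
  qed
  \<comment> \<open>In this order the blocks \<alpha> and \<beta> lie below the diagonal, while A,
    \<gamma> and \<delta> lie above it.\<close>
  moreover have "borel_of r \<subseteq> translation_p"
  proof
    show "x \<in> translation_p" if "x \<in> borel_of r" for x
      using that by (induct x rule: blocks_induct)
        (auto simp: borel_of_def r_def q_def blocks_in_sl41_iff blocks_in_translation_p_iff
          forall_idx blocks_nth vec_eq_iff forall_2)
  qed
  ultimately show ?thesis
    unfolding parabolic_superalgebra_def using sub_superalgebra_translation_p by blast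
qed

section \<open>Computations in sl(2) and sl(2)-stable odd subspaces\<close>

lemma trace_zero [simp]: "trace (0 :: complex^2^2) = 0"
  by (simp add: trace_def)

definition sl2_h :: "complex^2^2" where
  "sl2_h = (\<chi> i j. if i = j then (if i = 1 then 1 else - 1) else 0)"

lemma trace_sl2_h: "trace sl2_h = 0"
  by (simp add: sl2_h_def trace_def sum_2)

text \<open>Consequently \<open>(ad h)^2\<close>, for \<open>h\<close> placed in the first factor,
  is the identity on the A and M blocks, where \<open>h\<close> multiplies from one side
  only.\<close>

lemma sl2_h_square: "sl2_h ** sl2_h = mat 1"
  by (simp add: sl2_h_def mat_def matrix_matrix_mult_def sum_2 vec_eq_iff forall_2)

lemma sl2_h_mult_eq_0_iff: "sl2_h *v v = 0 \<longleftrightarrow> v = 0" "v v* sl2_h = 0 \<longleftrightarrow> v = 0"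
  by (auto simp: sl2_h_def matrix_vector_mult_def vector_matrix_mult_def sum_2 vec_eq_iff forall_2)

text \<open>On 2x2 matrices \<open>(ad h)^2\<close> has eigenvalues 0 (diagonal entries) and 4
  (off-diagonal entries), so 1 is not an eigenvalue.\<close>

lemma sl2_h_double_commutator_eq:
  assumes "sl2_h ** (sl2_h ** L - L ** sl2_h) - (sl2_h ** L - L ** sl2_h) ** sl2_h = L"
  shows "L = 0"
  using assms by (simp add: sl2_h_def matrix_matrix_mult_def sum_2 vec_eq_iff forall_2)

text \<open>The two off-diagonal matrix units show that column 1 of \<open>M\<close> or row 2 of
  \<open>A\<close> vanishes, and that column 2 of \<open>M\<close> or row 1 of \<open>A\<close>
  vanishes. The matrix \<open>sl2_h\<close> equates the two remaining products, column 1 times row 1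
  and column 2 times row 2, which rules out the mixed cases.\<close>

lemma sl2_sandwich_eq_0:
  fixes M A :: "complex^2^2"
  assumes "\<And>X. trace X = 0 \<Longrightarrow> M ** X ** A = 0"
  shows "M = 0 \<or> A = 0"
proof -
  have "trace ((\<chi> i j. if i = 1 \<and> j = 2 then 1 else 0) :: complex^2^2) = 0"
    "trace ((\<chi> i j. if i = 2 \<and> j = 1 then 1 else 0) :: complex^2^2) = 0"
    by (simp_all add: trace_def sum_2)
  from this[THEN assms] assms[OF trace_sl2_h] show ?thesis
    by (auto simp: sl2_h_def matrix_matrix_mult_def sum_2 vec_eq_iff forall_2)
qed

lemma minus_matrix_mult: "(- A) ** B = - (A ** B)" for A B :: "complex^2^2"
  by (simp add: matrix_matrix_mult_def vec_eq_iff sum_negf)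

lemma trace_minus_transpose: "trace (- transpose L) = - trace L" for L :: "complex^2^2"
  by (simp add: trace_def transpose_def sum_negf)

lemma vector_minus_transpose_matrix: "v v* (- transpose L) = - (L *v v)" for L :: "complex^2^2"
  by (simp add: transpose_def matrix_vector_mult_def vector_matrix_mult_def vec_eq_iff mult_ac sum_negf)

lemma lorentz_blocks: "trace X = 0 \<Longrightarrow> trace Y = 0 \<Longrightarrow> blocks X 0 0 0 Y 0 0 0 0 \<in> lorentz"
  by (auto simp: lorentz_def)

text \<open>The first sl(2) factor annihilates the \<delta> block and the second one the \<gamma>
  block, so acting with one factor isolates a component; irreducibility then yields the whole block.
  It is applied both to the odd part of \<open>n\<close> and to \<open>p\<close>.\<close>

lemma lorentz_stable_odd:
  assumes S: "cmat.subspace S" and stable: "\<And>X v. X \<in> lorentz \<Longrightarrow> v \<in> S \<Longrightarrow> sbracket X v \<in> S"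
    and x: "blocks 0 0 \<gamma> 0 0 0 0 \<delta> 0 \<in> S"
  shows "\<gamma> \<noteq> 0 \<Longrightarrow> blocks 0 0 \<gamma>' 0 0 0 0 0 0 \<in> S" "\<delta> \<noteq> 0 \<Longrightarrow> blocks 0 0 0 0 0 0 0 \<delta>' 0 \<in> S"
proof -
  define W where "W = {v. blocks 0 0 v 0 0 0 0 0 0 \<in> S}"
  have W: "W = {0} \<or> W = UNIV"
  proof (rule sl2_irreducible)
    show "vec.subspace W"
      using cmat.subspace_0[OF S] cmat.subspace_add[OF S, of "blocks 0 0 _ 0 0 0 0 0 0" "blocks 0 0 _ 0 0 0 0 0 0"]
        cmat.subspace_scale[OF S, of "blocks 0 0 _ 0 0 0 0 0 0"]
      unfolding vec.subspace_def W_def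
      by (auto simp: blocks_zero blocks_add mscale_blocks) (simp add: zero_vec_def[symmetric])
    show "L *v v \<in> W" if "trace L = 0" "v \<in> W" for L v
      using stable[OF lorentz_blocks[of L 0], of "blocks 0 0 v 0 0 0 0 0 0"] that
      by (simp add: W_def sbracket_lorentz)
  qed
  \<comment> \<open>Acting by \<open>sl2_h\<close> in the first factor removes \<delta>, and since
    \<open>sl2_h\<close> is invertible a nonzero \<gamma> stays nonzero.\<close>
  have h: "sl2_h *v \<gamma> \<in> W"
    using stable[OF lorentz_blocks[of sl2_h 0] x] by (simp add: W_def sbracket_lorentz trace_sl2_h)
  show "blocks 0 0 \<gamma>' 0 0 0 0 0 0 \<in> S" if "\<gamma> \<noteq> 0"
  proof -
    from that have "sl2_h *v \<gamma> \<noteq> 0" by (simp add: sl2_h_mult_eq_0_iff)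
    with W h have "\<gamma>' \<in> W" by blast
    then show ?thesis by (simp add: W_def)
  qed
  define W' where "W' = {v. blocks 0 0 0 0 0 0 0 v 0 \<in> S}"
  have W': "W' = {0} \<or> W' = UNIV"
  proof (rule sl2_irreducible)
    show "vec.subspace W'"
      using cmat.subspace_0[OF S] cmat.subspace_add[OF S, of "blocks 0 0 0 0 0 0 0 _ 0" "blocks 0 0 0 0 0 0 0 _ 0"]
        cmat.subspace_scale[OF S, of "blocks 0 0 0 0 0 0 0 _ 0"]
      unfolding vec.subspace_def W'_def
      by (auto simp: blocks_zero blocks_add mscale_blocks) (simp add: zero_vec_def[symmetric])
    \<comment> \<open>The \<delta> block carries the dual action, so \<open>- transpose L\<close> is
      the element of the second factor that acts on it as \<open>L\<close>.\<close>
    show "L *v v \<in> W'" if "trace L = 0" "v \<in> W'" for L v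
      using stable[OF lorentz_blocks[of 0 "- transpose L"], of "blocks 0 0 0 0 0 0 0 v 0"] that
      by (simp add: W'_def sbracket_lorentz trace_minus_transpose vector_minus_transpose_matrix)
  qed
  have h': "- (\<delta> v* sl2_h) \<in> W'"
    using stable[OF lorentz_blocks[of 0 sl2_h] x] by (simp add: W'_def sbracket_lorentz trace_sl2_h)
  show "blocks 0 0 0 0 0 0 0 \<delta>' 0 \<in> S" if "\<delta> \<noteq> 0"
  proof -
    from that have "- (\<delta> v* sl2_h) \<noteq> 0" by (simp add: sl2_h_mult_eq_0_iff)
    with W' h' have "\<delta>' \<in> W'" by blast
    then show ?thesis by (simp add: W'_def)
  qed
qed

section \<open>Uniqueness: the shape of \<open>n\<close>, then that of \<open>p\<close>\<close>

lemma translation_complement_even: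
  assumes p: "p \<inter> sl41_part 0 = parabolic_even" and n: "translation_complement p n"
    and y: "y \<in> n \<inter> sl41_part 0"
  shows "\<exists>A. y = blocks 0 A 0 0 0 0 0 0 0"
proof -
  interpret translation_superalgebra mscale "\<lambda>k. n \<inter> sl41_part k" sbracket sbracket
    using n by (simp add: translation_complement_def)
  interpret n0: lorentz_module mscale "n \<inter> sl41_part 0" sbracket by (rule parts_lorentz_module)
  have disjoint: "z = 0" if "z \<in> n \<inter> sl41_part 0" "z \<in> parabolic_even" for z
    using that p n by (auto simp: translation_complement_def direct_sum_decomp_def)
  obtain L A M R c where yb: "y = blocks L A 0 M R 0 0 0 c" and c: "c = trace L + trace R"
    using y by (induct y rule: blocks_induct) (auto simp: blocks_in_sl41_part_iff blocks_eq_iff)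
  define X where "X = blocks sl2_h 0 0 0 0 0 0 0 0"
  have X: "X \<in> lorentz" by (simp add: X_def lorentz_blocks trace_sl2_h)
  \<comment> \<open>The double bracket fixes the A and M blocks and kills R and c, so the difference
    has zero A and M blocks and falls into \<open>parabolic_even\<close>.\<close>
  define z where "z = sbracket X (sbracket X y) - y"
  have z: "z \<in> n \<inter> sl41_part 0"
    unfolding z_def using n0.act_closed[OF X] cmat.subspace_diff[OF part_subspace] y by blast
  define L' where "L' = sl2_h ** (sl2_h ** L - L ** sl2_h) - (sl2_h ** L - L ** sl2_h) ** sl2_h"
  have zb: "z = blocks (L' - L) 0 0 0 (- R) 0 0 0 (- c)"
    by (simp add: z_def X_def yb sbracket_lorentz trace_sl2_h blocks_diff L'_def sl2_h_square
        matrix_mul_assoc[of sl2_h sl2_h] matrix_mul_assoc[of M sl2_h sl2_h, symmetric]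
        minus_matrix_mult blocks_eq_iff)
  with z have "z \<in> parabolic_even"
    by (simp add: blocks_in_sl41_part_iff blocks_in_parabolic_even_iff)
  with z have "z = 0" by (rule disjoint)
  then have LRc: "L = 0" "R = 0" "c = 0"
    using sl2_h_double_commutator_eq[of L] by (simp_all add: zb blocks_eq_0_iff L'_def)
  have "M ** X ** A = 0" if "trace X = 0" for X
  proof -
    \<comment> \<open>Both arguments lie in the abelian even part of \<open>n\<close>. Comparing the
      R blocks of the two products gives \<open>M ** X ** A\<close> equal to its own
      negative.\<close>
    have "sbracket y (sbracket (blocks X 0 0 0 0 0 0 0 0) y) = 0"
      using that by (intro even_abelian n0.act_closed y lorentz_blocks) auto
    moreover have "sbracket (blocks X 0 0 0 0 0 0 0 0) y = blocks 0 (X ** A) 0 (- (M ** X)) 0 0 0 0 0"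
      using that by (simp add: yb LRc sbracket_lorentz)
    ultimately have "M ** (X ** A) = (- (M ** X)) ** A"
      using y by (simp add: sbracket_even) (simp add: yb LRc blocks_mult blocks_eq_iff)
    then show ?thesis
      by (simp add: minus_matrix_mult matrix_mul_assoc vec_eq_iff eq_neg_iff_add_eq_0)
  qed
  then have "M = 0 \<or> A = 0" by (rule sl2_sandwich_eq_0)
  then have "M = 0"
  proof
    assume "A = 0"
    then have "y = 0" using y by (intro disjoint) (simp_all add: yb LRc blocks_in_parabolic_even_iff)
    then show ?thesis by (simp add: yb blocks_eq_0_iff)
  qed
  with yb LRc show ?thesis by blast
qed

lemma translation_complement_odd:
  assumes p: "p \<inter> sl41_part 0 = parabolic_even" and n: "translation_complement p n"
  shows "blocks 0 0 \<gamma> 0 0 0 0 0 0 \<in> n" "blocks 0 0 0 0 0 0 0 \<delta> 0 \<in> n"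
proof -
  interpret translation_superalgebra mscale "\<lambda>k. n \<inter> sl41_part k" sbracket sbracket
    using n by (simp add: translation_complement_def)
  interpret n1: lorentz_module mscale "n \<inter> sl41_part 1" sbracket by (rule parts_lorentz_module)
  obtain x where x: "x \<in> n \<inter> sl41_part 1" and nonzero: "sbracket x x \<noteq> 0"
  proof -
    obtain x y where xy: "x \<in> n \<inter> sl41_part 1" "y \<in> n \<inter> sl41_part 1" "sbracket x y \<noteq> 0"
      using odd_nonzero by blast
    \<comment> \<open>Polarization: the mixed term is twice \<open>sbracket x y\<close>, so
      \<open>x\<close>, \<open>y\<close> and \<open>x + y\<close> cannot all have zero
      square.\<close>
    have "sbracket (x + y) (x + y) = sbracket x x + sbracket y y + (sbracket x y + sbracket x y)"
      using odd_symmetric[OF xy(1,2)] by (simp add: sbracket_add)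
    moreover have "sbracket x y + sbracket x y \<noteq> 0"
      using xy(3) by (simp add: vec_eq_iff)
    moreover have "x + y \<in> n \<inter> sl41_part 1"
      using xy cmat.subspace_add[OF part_subspace] by blast
    ultimately show thesis using that xy by (metis add_0)
  qed
  obtain g a b d where xb: "x = blocks 0 0 g 0 0 a b d 0"
    using x by (induct x rule: blocks_induct) (auto simp: blocks_in_sl41_part_iff blocks_eq_iff)
  have "sbracket x x \<in> n \<inter> sl41_part 0"
    using br_closed[OF x x] by simp
  then obtain A where "sbracket x x = blocks 0 A 0 0 0 0 0 0 0"
    using translation_complement_even[OF p n] by blast
  moreover have "sbracket x x = blocks (outer g b + outer g b) (outer g d + outer g d) 0
      (outer a b + outer a b) (outer a d + outer a d) 0 0 0 (vdot b g + vdot d a + (vdot b g + vdot d a))"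
    by (simp add: xb sbracket_def hpart_blocks blocks_mult blocks_add blocks_diff blocks_zero)
  moreover have "B + B = 0 \<longleftrightarrow> B = 0" for B :: "complex^2^2"
    by (simp add: vec_eq_iff)
  ultimately have "outer g b = 0" "outer a b = 0" "outer a d = 0" "outer g d \<noteq> 0"
    using nonzero by (auto simp: blocks_eq_iff blocks_eq_0_iff)
  \<comment> \<open>An outer product vanishes only if a factor does: the nonzero A block gives
    \<open>g\<close> and \<open>d\<close> nonzero, and then the vanishing L and R blocks force
    \<open>b\<close> and \<open>a\<close> to be zero.\<close>
  then have "g \<noteq> 0" "d \<noteq> 0" "b = 0" "a = 0"
    by (auto simp: outer_eq_0_iff)
  with x xb have "blocks 0 0 g 0 0 0 0 d 0 \<in> n \<inter> sl41_part 1" by simp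
  from lorentz_stable_odd[OF part_subspace n1.act_closed this, of \<gamma>]
    lorentz_stable_odd[OF part_subspace n1.act_closed this, of \<delta>] \<open>g \<noteq> 0\<close> \<open>d \<noteq> 0\<close>
  show "blocks 0 0 \<gamma> 0 0 0 0 0 0 \<in> n" "blocks 0 0 0 0 0 0 0 \<delta> 0 \<in> n" by blast+
qed

lemma parabolic_eq_translation_p:
  assumes parabolic: "parabolic_superalgebra p" and p: "p \<inter> sl41_part 0 = parabolic_even"
    and n: "translation_complement p n"
  shows "p = translation_p"
proof -
  obtain r where sub: "sub_superalgebra p" and r: "linear_order r" and borel: "borel_of r \<subseteq> p"
    using parabolic by (auto simp: parabolic_superalgebra_def borel_subalgebra_def)
  have subspace: "cmat.subspace p" and sl41: "p \<subseteq> sl41" and parts: "x \<in> p \<Longrightarrow> hpart k x \<in> p" for x k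
    using sub by (auto simp: sub_superalgebra_iff)
  \<comment> \<open>This makes \<open>p\<close> stable under the Lorentz algebra, so that
    \<open>lorentz_stable_odd\<close> applies to \<open>p\<close> as well.\<close>
  have "lorentz \<subseteq> p"
    using p by (auto simp: lorentz_def blocks_in_parabolic_even_iff simp flip: Int_iff)
  then have stable: "sbracket X v \<in> p" if "X \<in> lorentz" "v \<in> p" for X v
    using that sub by (auto simp: sub_superalgebra_iff)
  have disjoint: "p \<inter> n = {0}"
    using n by (simp add: translation_complement_def direct_sum_decomp_def)
  \<comment> \<open>A nonzero block would bring a full \<gamma> or \<delta> block into
    \<open>p\<close>, and \<open>n\<close> already contains both.\<close>
  have not_in_p: "\<gamma> = 0 \<and> \<delta> = 0" if "blocks 0 0 \<gamma> 0 0 0 0 \<delta> 0 \<in> p" for \<gamma> \<delta>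
  proof -
    have "blocks 0 0 (axis 1 1) 0 0 0 0 0 0 \<in> p" if "\<gamma> \<noteq> 0"
      by (rule lorentz_stable_odd(1)[OF subspace stable \<open>_ \<in> p\<close> that])
    moreover have "blocks 0 0 0 0 0 0 0 (axis 1 1) 0 \<in> p" if "\<delta> \<noteq> 0"
      by (rule lorentz_stable_odd(2)[OF subspace stable \<open>_ \<in> p\<close> that])
    ultimately show ?thesis
      using disjoint translation_complement_odd[OF p n, of "axis 1 1"]
      by (metis IntI singletonD blocks_eq_0_iff axis_eq_0_iff zero_neq_one)
  qed
  have total: "(i, j) \<in> r" if "(j, i) \<notin> r" for i j
    using r that by (cases "i = j")
      (auto simp: linear_order_on_def total_on_def partial_order_on_def preorder_on_def refl_on_def)
  \<comment> \<open>With the opposite order the Borel subalgebra, and hence \<open>p\<close>, would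
    contain a root vector in the \<gamma> block; \<open>r2\<close> excludes the \<delta> block in
    the same way.\<close>
  have r1: "(Inl (Inl k), Inr 1) \<in> r" for k
  proof (rule total, rule notI)
    assume "(Inr 1, Inl (Inl k)) \<in> r"
    then have "blocks 0 0 (axis k 1) 0 0 0 0 0 0 \<in> borel_of r"
      by (auto simp: borel_of_def blocks_in_sl41_iff forall_idx blocks_nth axis_def trace_def)
    with borel not_in_p[of "axis k 1" 0] show False by (auto simp: axis_eq_0_iff)
  qed
  have r2: "(Inr 1, Inl (Inr k)) \<in> r" for k
  proof (rule total, rule notI)
    assume "(Inl (Inr k), Inr 1) \<in> r"
    then have "blocks 0 0 0 0 0 0 0 (axis k 1) 0 \<in> borel_of r"
      by (auto simp: borel_of_def blocks_in_sl41_iff forall_idx blocks_nth axis_def trace_def)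
    with borel not_in_p[of 0 "axis k 1"] show False by (auto simp: axis_eq_0_iff)
  qed
  \<comment> \<open>By \<open>r1\<close> and \<open>r2\<close> the odd coordinate sits between the
    two even pairs in \<open>r\<close>, so all \<alpha> and \<beta> entries are lower
    triangular.\<close>
  have lower: "blocks 0 0 0 0 0 \<alpha> \<beta> 0 0 \<in> p" for \<alpha> \<beta>
  proof -
    have "blocks 0 0 0 0 0 \<alpha> \<beta> 0 0 \<in> borel_of r"
      using r1 r2 by (auto simp: borel_of_def blocks_in_sl41_iff forall_idx blocks_nth trace_def)
    with borel show ?thesis by blast
  qed
  show ?thesis
  proof (intro equalityI subsetI)
    fix x assume x: "x \<in> p"
    obtain L A \<gamma> M R \<alpha> \<beta> \<delta> c where xb: "x = blocks L A \<gamma> M R \<alpha> \<beta> \<delta> c" by (rule blocks_exhaust)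
    have "hpart 0 x \<in> p \<inter> sl41_part 0"
      using x parts sl41 hpart_in_sl41_part by blast
    then have "A = 0" "c = trace L + trace R"
      by (simp_all add: p xb hpart_blocks blocks_in_parabolic_even_iff)
    \<comment> \<open>Subtracting the \<alpha> and \<beta> blocks, already known to lie in
      \<open>p\<close>, from the odd part of \<open>x\<close> leaves an element to which
      \<open>not_in_p\<close> applies.\<close>
    moreover have "blocks 0 0 \<gamma> 0 0 0 0 \<delta> 0 \<in> p"
      using cmat.subspace_diff[OF subspace parts[OF x, of 1] lower[of \<alpha> \<beta>]]
      by (simp add: xb hpart_blocks blocks_diff)
    then have "\<gamma> = 0 \<and> \<delta> = 0" by (rule not_in_p)
    ultimately show "x \<in> translation_p" by (simp add: xb blocks_in_translation_p_iff)
  next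
    fix x assume "x \<in> translation_p"
    then obtain L M R \<alpha> \<beta> c where "x = blocks L 0 0 M R \<alpha> \<beta> 0 c" and c: "c = trace L + trace R"
      by (auto simp: translation_p_def)
    then have "x = blocks L 0 0 M R 0 0 0 c + blocks 0 0 0 0 0 \<alpha> \<beta> 0 0"
      by (simp add: blocks_add)
    moreover have "blocks L 0 0 M R 0 0 0 c \<in> p \<inter> sl41_part 0"
      by (simp add: p c blocks_in_parabolic_even_iff)
    ultimately show "x \<in> p"
      using cmat.subspace_add[OF subspace] lower by blast
  qed
qed

theorem lemma4p1:
  shows "(\<exists>!p. parabolic_superalgebra p \<and> p \<inter> sl41_part 0 = parabolic_even \<and>
            (\<exists>n. translation_complement p n))
    \<and> parabolic_superalgebra translation_p \<and> translation_p \<inter> sl41_part 0 = parabolic_even \<and>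
      translation_complement translation_p translation_n"
proof -
  have t: "parabolic_superalgebra translation_p" "translation_p \<inter> sl41_part 0 = parabolic_even"
    "translation_complement translation_p translation_n"
    by (rule parabolic_superalgebra_translation_p translation_p_even translation_complement_translation_n)+
  have "\<exists>!p. parabolic_superalgebra p \<and> p \<inter> sl41_part 0 = parabolic_even \<and>
            (\<exists>n. translation_complement p n)"
    by (rule ex1I[of _ translation_p]) (use t parabolic_eq_translation_p in blast)+
  with t show ?thesis by simp
qed

end
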